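(* Let $n\ge1$. For every $\epsilon\ge0$, the set $\mathcal K_{\mathrm{nc},\epsilon}\subseteq\mathcal S^n$ is convex. Moreover, $$\bigcap_{\epsilon>0}\mathcal K_{\mathrm{nc},\epsilon}\subseteq\mathcal{CS}_+^{n*},$$ and equality holds if Connes' embedding conjecture holds.
   Context: $\mathcal S^d$ denotes the real symmetric $d\times d$ matrices with trace inner product $\langle X,Y\rangle=\mathrm{Tr}(XY)$, and $\mathcal S^d_+$ the positive semidefinite ones. $\mathcal{CS}_+^n$ is the set of $A\in\mathcal S^n$ for which there exist $d\ge1$ and $X_1,\dots,X_n\in\mathcal S^d_+$ with $A_{ij}=\langle X_i,X_j\rangle$ for all $i,j$; $\mathcal{CS}_+^{n*}=\{M\in\mathcal S^n:\langle M,A\rangle\ge0\ \forall A\in\mathcal{CS}_+^n\}$. $\mathbb R\langle\underline X\rangle$ is the ring of real polynomials in non-commutative variables $X_1,\dots,X_n$, with the linear involution $*$ fixing each variable and reversing each monomial; $f$ is symmetric if $f^*=f$. A commutator is a polynomial $[f,g]=fg-gf$. The tracial quadratic module of the ball, $\mathrm{tr}\mathcal M^{\mathrm{ball}}_{\mathrm{nc}}$, is the set of polynomials of the form $h+\sum_{j=1}^{m_0}f_jf_j^*+\sum_{j=1}^{m_1}g_j\big(1-\sum_{i=1}^nX_i^2\big)g_j^*$, where $h$ is a sum of commutators, $f_j,g_j\in\mathbb R\langle\underline X\rangle$ and $m_0,m_1\in\mathbb N$. For $M\in\mathcal S^n$ let $p_M=\sum_{i,j=1}^nM_{ij}X_i^2X_j^2\in\mathbb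 R\langle\underline X\rangle$. For $\epsilon\ge0$, $\mathcal K_{\mathrm{nc},\epsilon}=\{M\in\mathcal S^n: p_M+\epsilon\in\mathrm{tr}\mathcal M^{\mathrm{ball}}_{\mathrm{nc}}\}$. Connes' embedding conjecture: every separable II$_1$ factor embeds (trace-preservingly) into an ultrapower $\mathcal R^\omega$ of the hyperfinite II$_1$ factor $\mathcal R$. It is used in the following form, known (Klep–Schweighofer, Burgdorf et al.) to be equivalent to it: for every $n$ and every symmetric $f\in\mathbb R\langle\underline X\rangle$, one has $\mathrm{Tr}(f(X_1,\dots,X_n))\ge0$ for all $d\ge1$ and all $(X_1,\dots,X_n)\in(\mathcal S^d)^n$ with $I-\sum_{i=1}^nX_i^2\succeq0$ if and only if $f+\epsilon\in\mathrm{tr}\mathcal M^{\mathrm{ball}}_{\mathrm{nc}}$ for all $\epsilon>0$. *)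

theory Defs
  imports "HOL-Library.Poly_Mapping" "Jordan_Normal_Form.Matrix"
begin

section \<open>Symmetric matrices and the completely positive semidefinite cone\<close>

definition mtrace :: "real mat \<Rightarrow> real" where
  "mtrace A = (\<Sum>i<dim_row A. A $$ (i, i))"

definition sym_mats :: "nat \<Rightarrow> real mat set" where
  "sym_mats d = {A \<in> carrier_mat d d. A\<^sup>T = A}"

definition psd_mats :: "nat \<Rightarrow> real mat set" where
  "psd_mats d = {A \<in> sym_mats d. \<forall>v \<in> carrier_vec d. 0 \<le> v \<bullet> (A *\<^sub>v v)}"

definition mat_inner :: "real mat \<Rightarrow> real mat \<Rightarrow> real" where
  "mat_inner X Y = mtrace (X * Y)"

definition CS_plus :: "nat \<Rightarrow> real mat set" where
  "CS_plus n = {A \<in> sym_mats n. \<exists>d\<ge>1. \<exists>X :: nat \<Rightarrow> real mat.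
     (\<forall>i<n. X i \<in> psd_mats d) \<and> (\<forall>i<n. \<forall>j<n. A $$ (i, j) = mat_inner (X i) (X j))}"

definition CS_plus_dual :: "nat \<Rightarrow> real mat set" where
  "CS_plus_dual n = {M \<in> sym_mats n. \<forall>A \<in> CS_plus n. 0 \<le> mat_inner M A}"

text \<open>The definiens of the library's \<^term>\<open>convex\<close>, which is not applicable itself because
  the type of matrices of arbitrary dimensions is not a real vector space.\<close>

definition convex_mats :: "real mat set \<Rightarrow> bool" where
  "convex_mats K \<longleftrightarrow> (\<forall>A\<in>K. \<forall>B\<in>K. \<forall>u\<ge>0. \<forall>v\<ge>0. u + v = 1 \<longrightarrow> u \<cdot>\<^sub>m A + v \<cdot>\<^sub>m B \<in> K)"


section \<open>Non-commutative polynomials\<close>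

text \<open>Words are wrapped in a datatype so that concatenation can serve as the addition of a
  (non-commutative) \<^class>\<open>monoid_add\<close>. The convolution product that the library defines on
  finitely supported functions then makes \<open>nc_poly\<close> the free real algebra on the letters
  \<open>0, 1, 2, \<dots>\<close>; the ring in the first \<open>n\<close> variables is its subset \<open>nc_polys n\<close>.\<close>

datatype nc_word = Word (letters: "nat list")

instantiation nc_word :: monoid_add
begin

definition zero_nc_word :: nc_word where
  "0 = Word []"

definition plus_nc_word :: "nc_word \<Rightarrow> nc_word \<Rightarrow> nc_word" where
  "u + v = Word (letters u @ letters v)"

instance
  by standard (simp_all add: zero_nc_word_def plus_nc_word_def)

end

type_synonym nc_poly = "nc_word \<Rightarrow>\<^sub>0 real"

definition nc_polys :: "nat \<Rightarrow> nc_poly set" where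
  "nc_polys n = {f. \<forall>w \<in> Poly_Mapping.keys f. set (letters w) \<subseteq> {..<n}}"

definition nc_const :: "real \<Rightarrow> nc_poly" where
  "nc_const c = Poly_Mapping.single 0 c"

definition nc_var :: "nat \<Rightarrow> nc_poly" where
  "nc_var i = Poly_Mapping.single (Word [i]) 1"

definition rev_word :: "nc_word \<Rightarrow> nc_word" where
  "rev_word w = Word (rev (letters w))"

lemma rev_word_rev_word [simp]: "rev_word (rev_word w) = w"
  by (simp add: rev_word_def)

lemma inj_rev_word: "inj rev_word"
  by (metis injI rev_word_rev_word)

definition nc_star :: "nc_poly \<Rightarrow> nc_poly" where
  "nc_star f = Poly_Mapping.map_key rev_word f"

lemma lookup_nc_star: "Poly_Mapping.lookup (nc_star f) w = Poly_Mapping.lookup f (rev_word w)"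
  by (simp add: nc_star_def map_key.rep_eq inj_rev_word)

lemma nc_star_single: "nc_star (Poly_Mapping.single w c) = Poly_Mapping.single (rev_word w) c"
  by (rule poly_mapping_eqI) (auto simp: lookup_nc_star lookup_single when_def)

definition word_eval :: "nat \<Rightarrow> (nat \<Rightarrow> real mat) \<Rightarrow> nc_word \<Rightarrow> real mat" where
  "word_eval d X w = foldr (\<lambda>i A. X i * A) (letters w) (1\<^sub>m d)"

definition nc_eval :: "nat \<Rightarrow> (nat \<Rightarrow> real mat) \<Rightarrow> nc_poly \<Rightarrow> real mat" where
  "nc_eval d X f = mat d d (\<lambda>(a, b).
     \<Sum>w\<in>Poly_Mapping.keys f. Poly_Mapping.lookup f w * word_eval d X w $$ (a, b))"


section \<open>The tracial quadratic module of the ball\<close>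

definition sums_of_commutators :: "nat \<Rightarrow> nc_poly set" where
  "sums_of_commutators n = {(\<Sum>j<m. f j * g j - g j * f j) | (m :: nat) f g.
     \<forall>j<m. f j \<in> nc_polys n \<and> g j \<in> nc_polys n}"

definition tr_M_ball :: "nat \<Rightarrow> nc_poly set" where
  "tr_M_ball n =
     {h + (\<Sum>j<m0. f j * nc_star (f j))
        + (\<Sum>j<m1. g j * (1 - (\<Sum>i<n. nc_var i ^ 2)) * nc_star (g j)) | h f g (m0 :: nat) (m1 :: nat).
      h \<in> sums_of_commutators n \<and> (\<forall>j<m0. f j \<in> nc_polys n) \<and> (\<forall>j<m1. g j \<in> nc_polys n)}"

definition p_poly :: "nat \<Rightarrow> real mat \<Rightarrow> nc_poly" where
  "p_poly n M = (\<Sum>i<n. \<Sum>j<n. nc_const (M $$ (i, j)) * nc_var i ^ 2 * nc_var j ^ 2)"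

definition K_nc :: "nat \<Rightarrow> real \<Rightarrow> real mat set" where
  "K_nc n \<epsilon> = {M \<in> sym_mats n. p_poly n M + nc_const \<epsilon> \<in> tr_M_ball n}"


section \<open>Connes' embedding conjecture\<close>

definition nc_ball :: "nat \<Rightarrow> nat \<Rightarrow> (nat \<Rightarrow> real mat) set" where
  "nc_ball n d = {X. (\<forall>i<n. X i \<in> sym_mats d) \<and>
     1\<^sub>m d - mat d d (\<lambda>(a, b). \<Sum>i<n. (X i * X i) $$ (a, b)) \<in> psd_mats d}"

text \<open>The conjecture in its algebraic form, as a statement about trace-positive polynomials, which
  Klep--Schweighofer and Burgdorf et al. proved equivalent to the embeddability of all separable
  II-1 factors into an ultrapower of the hyperfinite II-1 factor.\<close>

definition connes_embedding_conjecture :: bool where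
  "connes_embedding_conjecture \<longleftrightarrow>
     (\<forall>n\<ge>1. \<forall>f \<in> nc_polys n. nc_star f = f \<longrightarrow>
        ((\<forall>d\<ge>1. \<forall>X \<in> nc_ball n d. 0 \<le> mtrace (nc_eval d X f)) \<longleftrightarrow>
         (\<forall>\<epsilon>>0. f + nc_const \<epsilon> \<in> tr_M_ball n)))"

end

theory Submission
  imports Defs "HOL-Computational_Algebra.Formal_Power_Series"
begin

text \<open>
  Elements of the tracial quadratic module have nonnegative trace on the matrix ball, and
  \<open>Tr (p\<^sub>M (Y)) = \<Sum> M\<^sub>i\<^sub>j \<langle>Y\<^sub>i\<^sup>2, Y\<^sub>j\<^sup>2\<rangle>\<close>. Positive semidefinite \<open>X\<^sub>i\<close> can be rescaled so that
  \<open>\<Sum> t X\<^sub>i \<le> I\<close>; their square roots then lie in the ball, and letting \<open>\<epsilon>\<close> tend to 0 gives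
  \<open>t\<^sup>2 \<langle>M, A\<rangle> \<ge> 0\<close> for the Gram matrix \<open>A\<close> of the \<open>X\<^sub>i\<close>. Conversely, the squares of a point of the
  ball are positive semidefinite, so \<open>p\<^sub>M\<close> is trace-positive on the ball for every \<open>M\<close> in the dual
  cone, and the conjecture applies to \<open>p\<^sub>M\<close>.
\<close>

section \<open>Square roots of positive semidefinite matrices\<close>

text \<open>The coefficients of the power series of \<open>sqrt (1 - x)\<close>. They are absolutely summable, so that
  the series can be evaluated at every matrix \<open>I - X\<close> with \<open>0 \<le> X \<le> I\<close>, even if \<open>X\<close> is singular.\<close>

definition sqrt_coeff :: "nat \<Rightarrow> real" where
  "sqrt_coeff k = (-1) ^ k * ((1/2) gchoose k)"

lemma sqrt_coeff_0 [simp]: "sqrt_coeff 0 = 1"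
  by (simp add: sqrt_coeff_def)

text \<open>The sign cancels against the falling factorial and leaves a rising one starting at
  \<open>-1/2\<close>; that first factor is the only negative one.\<close>

lemma sqrt_coeff_Suc_nonpos: "sqrt_coeff (Suc k) \<le> 0"
proof -
  have "sqrt_coeff (Suc k) = pochhammer (-1/2) (Suc k) / fact (Suc k)"
    by (simp add: sqrt_coeff_def gbinomial_pochhammer flip: power_add mult_2)
  also have "pochhammer (-1/2 :: real) (Suc k) = (-1/2) * pochhammer (1/2) k"
    by (simp add: pochhammer_rec)
  finally show ?thesis
    by (simp add: pochhammer_nonneg zero_le_divide_iff mult_le_0_iff)
qed

text \<open>An alternating partial sum along a binomial row collapses to a single coefficient with
  upper index lowered by one, here \<open>-1/2\<close>, whose sign is then visible.\<close>

lemma sum_sqrt_coeff_nonneg: "0 \<le> (\<Sum>k\<le>m. sqrt_coeff k)"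
proof -
  have "(\<Sum>k\<le>m. sqrt_coeff k) = (-1) ^ m * ((1/2 - 1 :: real) gchoose m)"
    unfolding sqrt_coeff_def gbinomial_sum_lower_neg [symmetric] by (simp add: mult.commute)
  also have "\<dots> = pochhammer (1/2) m / fact m"
    by (simp add: gbinomial_pochhammer flip: power_add mult_2)
  finally show ?thesis
    by (simp add: pochhammer_nonneg)
qed

text \<open>All coefficients but the first are nonpositive, so the absolute values add up to
  \<open>2\<close> minus an ordinary partial sum, which is nonnegative.\<close>

lemma summable_abs_sqrt_coeff: "summable (\<lambda>k. \<bar>sqrt_coeff k\<bar>)"
proof (rule summableI_nonneg_bounded)
  fix n
  show "(\<Sum>k<n. \<bar>sqrt_coeff k\<bar>) \<le> 2"
  proof (cases n)
    case (Suc m)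
    have "(\<Sum>k<n. \<bar>sqrt_coeff k\<bar>) = 1 - (\<Sum>k<m. sqrt_coeff (Suc k))"
      unfolding Suc sum.lessThan_Suc_shift
      by (simp add: abs_of_nonpos sqrt_coeff_Suc_nonpos sum_negf)
    also have "\<dots> = 2 - (\<Sum>k\<le>m. sqrt_coeff k)"
      unfolding lessThan_Suc_atMost [symmetric] sum.lessThan_Suc_shift by simp
    finally show ?thesis
      using sum_sqrt_coeff_nonneg [of m] by simp
  qed simp
qed simp

text \<open>The identity \<open>sqrt (1 - x) * sqrt (1 - x) = 1 - x\<close> read off
  coefficientwise. It follows from Vandermonde's convolution with both upper indices equal to
  \<open>1/2\<close>.\<close>

lemma sqrt_coeff_convolution:
  "(\<Sum>i\<le>m. sqrt_coeff i * sqrt_coeff (m - i)) = (if m = 0 then 1 else if m = 1 then -1 else 0)"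
proof -
  have "(\<Sum>i\<le>m. sqrt_coeff i * sqrt_coeff (m - i))
      = (\<Sum>i\<le>m. (-1) ^ m * (((1/2) gchoose i) * ((1/2) gchoose (m - i))))"
    by (intro sum.cong refl) (auto simp: sqrt_coeff_def simp flip: power_add)
  also have "\<dots> = (-1) ^ m * ((1 :: real) gchoose m)"
    using gbinomial_Vandermonde [of "1/2 :: real" "1/2" m]
    by (simp add: atMost_atLeast0 flip: sum_distrib_left)
  also have "(1 :: real) gchoose m = of_nat (1 choose m)"
    by (metis binomial_gbinomial of_nat_1)
  finally show ?thesis
    by (auto simp: binomial_eq_0)
qed

section \<open>Symmetric matrices, positive semidefinite contractions and their powers\<close>

lemma sym_mats_carrier: "A \<in> sym_mats d \<Longrightarrow> A \<in> carrier_mat d d"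
  by (simp add: sym_mats_def)

lemma sym_mats_index:
  assumes "A \<in> sym_mats d" "i < d" "j < d"
  shows "A $$ (i, j) = A $$ (j, i)"
proof -
  have "A \<in> carrier_mat d d" and T: "A\<^sup>T = A"
    using assms by (simp_all add: sym_mats_def)
  then have "A\<^sup>T $$ (j, i) = A $$ (i, j)"
    using assms by (intro index_transpose_mat(1)) auto
  then show ?thesis
    by (simp add: T)
qed

lemma psd_mats_carrier: "A \<in> psd_mats d \<Longrightarrow> A \<in> carrier_mat d d"
  by (simp add: psd_mats_def sym_mats_def)

lemma index_mult_mat_sum:
  assumes "A \<in> carrier_mat d d" "B \<in> carrier_mat d d" "i < d" "j < d"
  shows "(A * B) $$ (i, j) = (\<Sum>l<d. A $$ (i, l) * B $$ (l, j))"
  using assms by (simp add: scalar_prod_def lessThan_atLeast0)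

lemma sym_mats_scalar_prod:
  assumes "A \<in> sym_mats d" "v \<in> carrier_vec d" "w \<in> carrier_vec d"
  shows "v \<bullet> (A *\<^sub>v w) = (A *\<^sub>v v) \<bullet> w"
  using transpose_vec_mult_scalar [of A d d w v] assms by (auto simp: sym_mats_def)

text \<open>No diagonalisation is involved. With \<open>w = A v\<close>, positivity of
  \<open>A\<close> at \<open>v - w\<close> together with
  \<open>w \<bullet> A w \<le> w \<bullet> w\<close> gives
  \<open>w \<bullet> w \<le> v \<bullet> w\<close>, and \<open>A \<le> I\<close> at \<open>v\<close>
  gives \<open>v \<bullet> w \<le> v \<bullet> v\<close>.\<close>

lemma psd_contraction_norm_le:
  assumes A: "A \<in> psd_mats d" and A': "1\<^sub>m d - A \<in> psd_mats d" and v: "v \<in> carrier_vec d"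
  shows "(A *\<^sub>v v) \<bullet> (A *\<^sub>v v) \<le> v \<bullet> v"
proof -
  have sym: "A \<in> sym_mats d" and carr [simp]: "A \<in> carrier_mat d d"
    using A by (simp_all add: psd_mats_def sym_mats_def)
  have [simp]: "A *\<^sub>v u \<in> carrier_vec d" if "u \<in> carrier_vec d" for u
    using carr that by (rule mult_mat_vec_carrier)
  define w where "w = A *\<^sub>v v"
  have w [simp]: "w \<in> carrier_vec d"
    using v by (simp add: w_def)
  have pos: "0 \<le> u \<bullet> (A *\<^sub>v u)" "0 \<le> u \<bullet> u - u \<bullet> (A *\<^sub>v u)" if u: "u \<in> carrier_vec d" for u
  proof -
    show "0 \<le> u \<bullet> (A *\<^sub>v u)"
      using A u by (auto simp: psd_mats_def)
    have "0 \<le> u \<bullet> ((1\<^sub>m d - A) *\<^sub>v u)"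
      using A' u by (auto simp: psd_mats_def)
    also have "(1\<^sub>m d - A) *\<^sub>v u = u - A *\<^sub>v u"
      using u by (subst minus_mult_distrib_mat_vec [of _ d d]) auto
    also have "u \<bullet> (u - A *\<^sub>v u) = u \<bullet> u - u \<bullet> (A *\<^sub>v u)"
      using u by (subst scalar_prod_minus_distrib [of _ d]) auto
    finally show "0 \<le> u \<bullet> u - u \<bullet> (A *\<^sub>v u)" .
  qed
  have "(v - w) \<bullet> (A *\<^sub>v (v - w)) = (v - w) \<bullet> (w - A *\<^sub>v w)"
    using v by (simp add: mult_minus_distrib_mat_vec [of A d d] w_def [symmetric])
  also have "\<dots> = v \<bullet> w - w \<bullet> w - (v \<bullet> (A *\<^sub>v w) - w \<bullet> (A *\<^sub>v w))"
    using v by (simp add: scalar_prod_minus_distrib [of _ d] minus_scalar_prod_distrib [of _ d])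
  also have "v \<bullet> (A *\<^sub>v w) = w \<bullet> w"
    using sym_mats_scalar_prod [OF sym v w] by (simp add: w_def)
  finally show ?thesis
    using pos(1) [of "v - w"] pos(2) [OF w] pos(2) [OF v] v
    by (simp add: w_def [symmetric])
qed

lemma pow_mat_add:
  assumes "A \<in> carrier_mat d d"
  shows "A ^\<^sub>m (k + l) = A ^\<^sub>m k * (A ^\<^sub>m l :: real mat)"
proof (induction l)
  case 0
  have "A ^\<^sub>m k * 1\<^sub>m d = A ^\<^sub>m k"
    by (rule right_mult_one_mat) (rule pow_carrier_mat [OF assms])
  then show ?case
    by (simp add: carrier_matD [OF assms])
next
  case (Suc l)
  have "A ^\<^sub>m k * A ^\<^sub>m l * A = A ^\<^sub>m k * (A ^\<^sub>m l * A)"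
    by (rule assoc_mult_mat) (rule pow_carrier_mat [OF assms] assms)+
  with Suc show ?case
    by (simp del: assoc_mult_mat)
qed

lemma pow_mat_sym:
  assumes "A \<in> sym_mats d"
  shows "A ^\<^sub>m k \<in> sym_mats d"
proof (induction k)
  case 0
  then show ?case
    using assms by (auto simp: sym_mats_def)
next
  case (Suc k)
  have carr: "A \<in> carrier_mat d d" and pow: "A ^\<^sub>m k \<in> carrier_mat d d"
    using assms by (simp_all add: sym_mats_def)
  have "A ^\<^sub>m 1 = A"
    using carr by (simp add: carrier_matD [OF carr])
  have "(A ^\<^sub>m Suc k)\<^sup>T = A\<^sup>T * (A ^\<^sub>m k)\<^sup>T"
    unfolding pow_mat.simps by (rule transpose_mult [OF pow carr])
  \<comment> \<open>Transposition moves the new factor to the left, whereas powers grow on the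
    right. Writing it as a first power lets additivity of exponents swap the two.\<close>
  also have "\<dots> = A ^\<^sub>m 1 * A ^\<^sub>m k"
    using Suc assms \<open>A ^\<^sub>m 1 = A\<close> by (simp only: sym_mats_def mem_Collect_eq)
  also have "\<dots> = A ^\<^sub>m Suc k"
    by (simp only: pow_mat_add [OF carr, symmetric] plus_1_eq_Suc)
  finally show ?case
    using pow_carrier_mat [OF carr, of "Suc k"] unfolding sym_mats_def by blast
qed

lemma scalar_prod_self_nonneg:
  fixes v :: "real vec"
  shows "0 \<le> v \<bullet> v"
  unfolding scalar_prod_def by (intro sum_nonneg) simp

lemma scalar_prod_self_ge_square:
  fixes v :: "real vec"
  assumes "i < dim_vec v"
  shows "(v $ i)\<^sup>2 \<le> v \<bullet> v"
  unfolding scalar_prod_def power2_eq_square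
  by (rule member_le_sum) (use assms in auto)

text \<open>The entry is a component of the \<open>k\<close>-th power applied to a unit vector, and
  no power of \<open>A\<close> increases the norm. This uniform bound makes power series in
  \<open>A\<close> with absolutely summable coefficients converge.\<close>

lemma pow_mat_contraction_index:
  assumes A: "A \<in> psd_mats d" "1\<^sub>m d - A \<in> psd_mats d" and ij: "i < d" "j < d"
  shows "\<bar>(A ^\<^sub>m k) $$ (i, j)\<bar> \<le> 1"
proof -
  have carr [simp]: "A \<in> carrier_mat d d"
    using A by (intro psd_mats_carrier)
  have le: "(A ^\<^sub>m k *\<^sub>v v) \<bullet> (A ^\<^sub>m k *\<^sub>v v) \<le> v \<bullet> v" if "v \<in> carrier_vec d" for v
    using that
  proof (induction k arbitrary: v)
    case (Suc k)
    have eq: "A ^\<^sub>m Suc k *\<^sub>v v = A ^\<^sub>m k *\<^sub>v (A *\<^sub>v v)"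
      using Suc.prems assoc_mult_mat_vec [of "A ^\<^sub>m k" d d A d v] by simp
    have "A *\<^sub>v v \<in> carrier_vec d"
      using carr by (rule mult_mat_vec_carrier) (use Suc.prems in auto)
    then show ?case
      unfolding eq by (rule order_trans [OF Suc.IH psd_contraction_norm_le [OF A Suc.prems]])
  qed (use carr in \<open>auto simp: carrier_matD [OF carr]\<close>)
  have dims: "dim_row (A ^\<^sub>m k) = d" "dim_col (A ^\<^sub>m k) = d"
    using pow_mat_dim_square [OF carr] by auto
  have "(A ^\<^sub>m k) $$ (i, j) = (A ^\<^sub>m k *\<^sub>v unit_vec d j) $ i"
    using ij dims by (simp add: scalar_prod_right_unit)
  then have "((A ^\<^sub>m k) $$ (i, j))\<^sup>2 \<le> (A ^\<^sub>m k *\<^sub>v unit_vec d j) \<bullet> (A ^\<^sub>m k *\<^sub>v unit_vec d j)"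
    using scalar_prod_self_ge_square [of i "A ^\<^sub>m k *\<^sub>v unit_vec d j"] ij dims by simp
  also have "\<dots> \<le> unit_vec d j \<bullet> unit_vec d j"
    by (rule le) simp
  also have "\<dots> = 1"
    using ij by simp
  finally show ?thesis
    by (simp add: abs_square_le_1)
qed

text \<open>The root is the binomial series of \<open>sqrt (1 - x)\<close> evaluated entrywise at
  \<open>A = I - X\<close>. Its Cauchy square has only the terms \<open>I\<close> and
  \<open>-A\<close>, which add up to \<open>X\<close>.\<close>

lemma psd_contraction_sqrt:
  assumes X: "X \<in> psd_mats d" and X': "1\<^sub>m d - X \<in> psd_mats d"
  obtains Y where "Y \<in> sym_mats d" "Y * Y = X"
proof -
  define A where "A = 1\<^sub>m d - X"
  have [simp]: "X \<in> carrier_mat d d"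
    using X by (rule psd_mats_carrier)
  have carr [simp]: "A \<in> carrier_mat d d"
    unfolding A_def by (rule minus_carrier_mat) simp
  have "1\<^sub>m d - A = X"
    by (rule eq_matI) (auto simp: A_def)
  then have A: "A \<in> psd_mats d" "1\<^sub>m d - A \<in> psd_mats d"
    using X X' by (simp_all add: A_def)
  define t where "t i j k = sqrt_coeff k * (A ^\<^sub>m k) $$ (i, j)" for i j k
  have dims [simp]: "dim_row (A ^\<^sub>m k) = d" "dim_col (A ^\<^sub>m k) = d" for k
    using pow_mat_dim_square [OF carr] by auto
  have summable: "summable (\<lambda>k. norm (t i j k))" if "i < d" "j < d" for i j
  proof (rule summable_norm_comparison_test [OF _ summable_abs_sqrt_coeff])
    show "\<exists>N. \<forall>k\<ge>N. norm (t i j k) \<le> \<bar>sqrt_coeff k\<bar>"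
      using pow_mat_contraction_index [OF A that]
      by (auto simp: t_def abs_mult intro!: exI [of _ 0] mult_left_le)
  qed
  have sym_t: "t i j = t j i" if "i < d" "j < d" for i j
    using sym_mats_index [OF pow_mat_sym, of A d i j] A that
    by (simp add: t_def fun_eq_iff psd_mats_def)
  define Y where "Y = mat d d (\<lambda>(i, j). suminf (t i j))"
  show thesis
  proof
    show "Y \<in> sym_mats d"
      by (auto simp: Y_def sym_mats_def sym_t intro!: eq_matI)
    show "Y * Y = X"
    proof (rule eq_matI)
      fix i j assume ij: "i < dim_row X" "j < dim_col X"
      then have ij': "i < d" "j < d"
        by (auto simp: carrier_matD [OF \<open>X \<in> carrier_mat d d\<close>])
      have "(Y * Y) $$ (i, j) = (\<Sum>l<d. suminf (t i l) * suminf (t l j))"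
        using ij' by (simp add: Y_def scalar_prod_def lessThan_atLeast0)
      \<comment> \<open>Each product of two entry series is a Cauchy product of absolutely
        convergent series; summing over the inner index \<open>l\<close> then gives an entry of the
        matrix product.\<close>
      moreover have "(\<lambda>m. \<Sum>l<d. \<Sum>k\<le>m. t i l k * t l j (m - k)) sums \<dots>"
        by (intro sums_sum Cauchy_product_sums summable) (use ij' in auto)
      moreover have "(\<Sum>l<d. \<Sum>k\<le>m. t i l k * t l j (m - k))
          = (if m = 0 then 1 else if m = 1 then -1 else 0) * (A ^\<^sub>m m) $$ (i, j)" for m
      proof -
        have "(\<Sum>l<d. \<Sum>k\<le>m. t i l k * t l j (m - k))
            = (\<Sum>k\<le>m. sqrt_coeff k * sqrt_coeff (m - k) *
                (\<Sum>l<d. (A ^\<^sub>m k) $$ (i, l) * (A ^\<^sub>m (m - k)) $$ (l, j)))"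
          unfolding t_def sum_distrib_left by (subst sum.swap) (simp only: mult_ac)
        also have "\<dots> = (\<Sum>k\<le>m. sqrt_coeff k * sqrt_coeff (m - k) * (A ^\<^sub>m m) $$ (i, j))"
        proof (intro sum.cong refl)
          fix k assume "k \<in> {..m}"
          then have "A ^\<^sub>m m = A ^\<^sub>m k * A ^\<^sub>m (m - k)"
            using pow_mat_add [OF carr, of k "m - k"] by simp
          then have "(A ^\<^sub>m m) $$ (i, j) = (\<Sum>l<d. (A ^\<^sub>m k) $$ (i, l) * (A ^\<^sub>m (m - k)) $$ (l, j))"
            using ij' by (simp add: index_mult_mat_sum [of _ d])
          then show "sqrt_coeff k * sqrt_coeff (m - k) *
              (\<Sum>l<d. (A ^\<^sub>m k) $$ (i, l) * (A ^\<^sub>m (m - k)) $$ (l, j))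
              = sqrt_coeff k * sqrt_coeff (m - k) * (A ^\<^sub>m m) $$ (i, j)"
            by simp
        qed
        also have "\<dots> = (if m = 0 then 1 else if m = 1 then -1 else 0) * (A ^\<^sub>m m) $$ (i, j)"
          by (simp only: sum_distrib_right [symmetric] sqrt_coeff_convolution)
        finally show ?thesis .
      qed
      ultimately have "(\<lambda>m. (if m = 0 then 1 else if m = 1 then -1 else 0) * (A ^\<^sub>m m) $$ (i, j))
          sums ((Y * Y) $$ (i, j))"
        by (simp only:)
      \<comment> \<open>Only the terms for \<open>m = 0\<close> and \<open>m = 1\<close> survive, so
        the same series also has an explicit finite sum, and uniqueness of limits identifies the
        entry.\<close>
      moreover have "(\<lambda>m. (if m = 0 then 1 else if m = 1 then -1 else 0) * (A ^\<^sub>m m) $$ (i, j))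
          sums (\<Sum>m\<in>{0, 1}. (if m = 0 then 1 else if m = 1 then -1 else 0) * (A ^\<^sub>m m) $$ (i, j))"
        by (rule sums_finite) auto
      ultimately have "(Y * Y) $$ (i, j)
          = (\<Sum>m\<in>{0, 1}. (if m = 0 then 1 else if m = 1 then -1 else 0) * (A ^\<^sub>m m) $$ (i, j))"
        by (rule sums_unique2)
      also have "\<dots> = (1\<^sub>m d) $$ (i, j) - A $$ (i, j)"
        using ij' by (simp add: carrier_matD [OF carr])
      also have "\<dots> = X $$ (i, j)"
        using ij' by (simp add: A_def carrier_matD [OF \<open>X \<in> carrier_mat d d\<close>])
      finally show "(Y * Y) $$ (i, j) = X $$ (i, j)" .
    qed (simp_all add: Y_def carrier_matD [OF \<open>X \<in> carrier_mat d d\<close>])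
  qed
qed

section \<open>Scaling and bounding quadratic forms\<close>

lemma psd_mats_smult:
  assumes "X \<in> psd_mats d" "c \<ge> 0"
  shows "c \<cdot>\<^sub>m X \<in> psd_mats d"
proof -
  have [simp]: "X \<in> carrier_mat d d"
    using assms by (simp add: psd_mats_carrier)
  have "(c \<cdot>\<^sub>m X)\<^sup>T = c \<cdot>\<^sub>m X\<^sup>T"
    by (rule eq_matI) auto
  moreover have "v \<bullet> (c \<cdot>\<^sub>m X *\<^sub>v v) = c * (v \<bullet> (X *\<^sub>v v))" if "v \<in> carrier_vec d" for v
  proof -
    have "c \<cdot>\<^sub>m X *\<^sub>v v = c \<cdot>\<^sub>v (X *\<^sub>v v)"
      using that by (intro eq_vecI) (auto simp: carrier_matD [OF \<open>X \<in> carrier_mat d d\<close>])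
    moreover have "X *\<^sub>v v \<in> carrier_vec d"
      by (rule mult_mat_vec_carrier) (use that in auto)
    ultimately show ?thesis
      using that by simp
  qed
  ultimately show ?thesis
    using assms by (simp add: psd_mats_def sym_mats_def)
qed

lemma quadratic_form_eq:
  fixes X :: "real mat"
  assumes "X \<in> carrier_mat d d" "v \<in> carrier_vec d"
  shows "v \<bullet> (X *\<^sub>v v) = (\<Sum>i<d. \<Sum>j<d. X $$ (i, j) * (v $ i * v $ j))"
  using assms by (simp add: scalar_prod_def sum_distrib_left lessThan_atLeast0 mult_ac)

text \<open>A crude constant suffices for rescaling: the sum of the absolute values of all entries.
  Each \<open>\<bar>v $ i * v $ j\<bar>\<close> is at most \<open>v \<bullet> v\<close>, since twice
  a product is bounded by the sum of the squares.\<close>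

lemma quadratic_form_bound:
  fixes X :: "real mat"
  assumes "X \<in> carrier_mat d d"
  obtains c where "c \<ge> 0" "\<And>v. v \<in> carrier_vec d \<Longrightarrow> v \<bullet> (X *\<^sub>v v) \<le> c * (v \<bullet> v)"
proof
  define c where "c = (\<Sum>i<d. \<Sum>j<d. \<bar>X $$ (i, j)\<bar>)"
  show "c \<ge> 0"
    by (simp add: c_def sum_nonneg)
  fix v :: "real vec"
  assume v: "v \<in> carrier_vec d"
  have bound: "v $ i * v $ j \<le> v \<bullet> v" "- (v $ i * v $ j) \<le> v \<bullet> v" if "i < d" "j < d" for i j
    using scalar_prod_self_ge_square [of i v] scalar_prod_self_ge_square [of j v] that v
      sum_squares_bound [of "v $ i" "v $ j"] sum_squares_bound [of "v $ i" "- v $ j"]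
    by (simp_all add: mult.assoc)
  have "v \<bullet> (X *\<^sub>v v) = (\<Sum>i<d. \<Sum>j<d. X $$ (i, j) * (v $ i * v $ j))"
    by (rule quadratic_form_eq [OF assms v])
  also have "\<dots> \<le> (\<Sum>i<d. \<Sum>j<d. \<bar>X $$ (i, j)\<bar> * (v \<bullet> v))"
  proof (intro sum_mono)
    fix i j assume "i \<in> {..<d}" "j \<in> {..<d}"
    then have le: "\<bar>v $ i * v $ j\<bar> \<le> v \<bullet> v"
      using bound by (simp add: abs_le_iff)
    have "X $$ (i, j) * (v $ i * v $ j) \<le> \<bar>X $$ (i, j) * (v $ i * v $ j)\<bar>"
      by (rule abs_ge_self)
    also have "\<dots> = \<bar>X $$ (i, j)\<bar> * \<bar>v $ i * v $ j\<bar>"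
      by (rule abs_mult)
    also have "\<dots> \<le> \<bar>X $$ (i, j)\<bar> * (v \<bullet> v)"
      using le by (rule mult_left_mono) simp
    finally show "X $$ (i, j) * (v $ i * v $ j) \<le> \<bar>X $$ (i, j)\<bar> * (v \<bullet> v)" .
  qed
  also have "\<dots> = c * (v \<bullet> v)"
    by (simp add: c_def sum_distrib_right)
  finally show "v \<bullet> (X *\<^sub>v v) \<le> c * (v \<bullet> v)" .
qed


section \<open>The tracial quadratic module is a convex cone\<close>

text \<open>Reduces statements about polynomials to monomials. The step asks nothing about whether
  \<open>w\<close> already occurs in \<open>f\<close>, so additivity alone carries it.\<close>

lemma poly_mapping_single_plus_induct [case_names zero plus]:
  fixes f :: "'a \<Rightarrow>\<^sub>0 'b :: comm_monoid_add"
  assumes zero: "P 0" and plus: "\<And>w c f. P f \<Longrightarrow> P (Poly_Mapping.single w c + f)"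
  shows "P f"
proof -
  have "P (\<Sum>w\<in>A. Poly_Mapping.single w (Poly_Mapping.lookup f w))" if "finite A" for A
    using that by induction (auto intro: assms)
  moreover have "f = (\<Sum>w\<in>Poly_Mapping.keys f. Poly_Mapping.single w (Poly_Mapping.lookup f w))"
    by (rule poly_mapping_eqI)
      (auto simp: lookup_sum lookup_single when_def sum.If_cases in_keys_iff sum.delta
        intro!: sum.neutral)
  ultimately show ?thesis
    by (metis finite_keys)
qed

section \<open>Arithmetic and involution in the free algebra, and the polynomials
  \<open>p_poly\<close>\<close>

lemma nc_polys_zero [simp]: "0 \<in> nc_polys n"
  by (simp add: nc_polys_def)

lemma nc_polys_const [simp]: "nc_const c \<in> nc_polys n"
  by (simp add: nc_polys_def nc_const_def zero_nc_word_def)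

lemma nc_polys_single: "set (letters w) \<subseteq> {..<n} \<Longrightarrow> Poly_Mapping.single w c \<in> nc_polys n"
  by (simp add: nc_polys_def)

lemma nc_polys_add: "f \<in> nc_polys n \<Longrightarrow> g \<in> nc_polys n \<Longrightarrow> f + g \<in> nc_polys n"
  using Poly_Mapping.keys_add [of f g] by (auto simp: nc_polys_def)

lemma nc_polys_sum: "(\<And>i. i \<in> I \<Longrightarrow> f i \<in> nc_polys n) \<Longrightarrow> sum f I \<in> nc_polys n"
  by (induction I rule: infinite_finite_induct) (auto intro: nc_polys_add)

lemma nc_polys_mult: "f \<in> nc_polys n \<Longrightarrow> g \<in> nc_polys n \<Longrightarrow> f * g \<in> nc_polys n"
  using Poly_Mapping.keys_mult [of f g] unfolding nc_polys_def plus_nc_word_def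
  by (auto dest!: subsetD)

lemma nc_const_mult: "nc_const (a * b) = nc_const a * nc_const b"
  by (simp add: nc_const_def mult_single)

lemma nc_const_add: "nc_const (a + b) = nc_const a + nc_const b"
  by (simp add: nc_const_def single_add)

text \<open>Constants live on the empty word, which is neutral for concatenation, so they are
  central although the ring is not commutative.\<close>

lemma nc_const_commute: "nc_const c * f = f * nc_const c"
  by (induction f rule: poly_mapping_single_plus_induct)
    (simp_all add: nc_const_def mult_single distrib_left distrib_right mult.commute)

lemma nc_star_add: "nc_star (f + g) = nc_star f + nc_star g"
  by (rule poly_mapping_eqI) (simp add: lookup_nc_star lookup_add)

lemma nc_star_zero [simp]: "nc_star 0 = 0"
  by (rule poly_mapping_eqI) (simp add: lookup_nc_star)

lemma nc_star_sum: "nc_star (sum f I) = (\<Sum>i\<in>I. nc_star (f i))"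
  by (induction I rule: infinite_finite_induct) (simp_all add: nc_star_add)

lemma rev_word_add: "rev_word (u + v) = rev_word v + rev_word u"
  by (simp add: rev_word_def plus_nc_word_def)

lemma nc_star_single_mult:
  "nc_star (Poly_Mapping.single w c * f) = nc_star f * nc_star (Poly_Mapping.single w c)"
  by (induction f rule: poly_mapping_single_plus_induct)
    (simp_all add: nc_star_add distrib_left distrib_right mult_single nc_star_single rev_word_add
      mult.commute)

lemma nc_star_mult: "nc_star (f * g) = nc_star g * nc_star f"
  by (induction f rule: poly_mapping_single_plus_induct)
    (simp_all add: nc_star_add distrib_left distrib_right nc_star_single_mult)

lemma nc_star_const [simp]: "nc_star (nc_const c) = nc_const c"
  by (simp add: nc_const_def nc_star_single rev_word_def zero_nc_word_def)

lemma nc_var_power2: "nc_var i ^ 2 = Poly_Mapping.single (Word [i, i]) 1"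
  by (simp add: nc_var_def power2_eq_square mult_single plus_nc_word_def)

text \<open>The expansion into monomials, from which the variables that occur, the effect of the
  involution and linearity in \<open>M\<close> can be read off.\<close>

lemma p_poly_eq:
  "p_poly n M = (\<Sum>i<n. \<Sum>j<n. Poly_Mapping.single (Word [i, i, j, j]) (M $$ (i, j)))"
  by (simp add: p_poly_def nc_var_power2 nc_const_def mult_single plus_nc_word_def zero_nc_word_def)

lemma p_poly_in_nc_polys: "p_poly n M \<in> nc_polys n"
  unfolding p_poly_eq by (intro nc_polys_sum nc_polys_single) auto

text \<open>Reversal turns the word of the pair \<open>(i, j)\<close> into that of
  \<open>(j, i)\<close>, which symmetry of \<open>M\<close> compensates. The conjecture speaks of
  symmetric polynomials, so this is required before applying it.\<close>

lemma nc_star_p_poly: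
  assumes "M \<in> sym_mats n"
  shows "nc_star (p_poly n M) = p_poly n M"
proof -
  have "nc_star (p_poly n M)
      = (\<Sum>j<n. \<Sum>i<n. Poly_Mapping.single (Word [j, j, i, i]) (M $$ (i, j)))"
    unfolding p_poly_eq nc_star_sum nc_star_single by (subst sum.swap) (simp add: rev_word_def)
  also have "\<dots> = p_poly n M"
    unfolding p_poly_eq by (intro sum.cong refl) (simp add: sym_mats_index [OF assms])
  finally show ?thesis .
qed

lemma p_poly_combination:
  assumes "A \<in> carrier_mat n n" "B \<in> carrier_mat n n"
  shows "p_poly n (u \<cdot>\<^sub>m A + v \<cdot>\<^sub>m B) = nc_const u * p_poly n A + nc_const v * p_poly n B"
  using assms
  by (simp add: p_poly_eq nc_const_def sum_distrib_left mult_single single_add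
      flip: sum.distrib)

text \<open>Concatenation of two finite families. The summand is an arbitrary function
  \<open>F\<close> of the family member, so that commutators, squares and weighted squares are all
  instances.\<close>

lemma sum_lessThan_append:
  fixes F :: "'a \<Rightarrow> 'b :: comm_monoid_add" and m k :: nat
  shows "(\<Sum>j<m. F (f j)) + (\<Sum>j<k. F (g j)) = (\<Sum>j<m + k. F (if j < m then f j else g (j - m)))"
proof -
  have "(\<Sum>j<m + k. F (if j < m then f j else g (j - m)))
      = (\<Sum>j<m. F (if j < m then f j else g (j - m))) + (\<Sum>j=m..<m + k. F (if j < m then f j else g (j - m)))"
    unfolding lessThan_atLeast0 by (rule sum.atLeastLessThan_concat [symmetric]) simp_all
  also have "(\<Sum>j=m..<m + k. F (if j < m then f j else g (j - m))) = (\<Sum>j<k. F (g j))"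
    using sum.shift_bounds_nat_ivl [of "\<lambda>j. F (if j < m then f j else g (j - m))" 0 m k]
    by (simp add: lessThan_atLeast0 add.commute)
  finally show ?thesis
    by simp
qed

section \<open>Addition and scaling for sums of commutators and for the quadratic module\<close>

lemma sums_of_commutatorsI:
  fixes m :: nat
  assumes "h = (\<Sum>j<m. f j * g j - g j * f j)"
    "\<And>j. j < m \<Longrightarrow> f j \<in> nc_polys n" "\<And>j. j < m \<Longrightarrow> g j \<in> nc_polys n"
  shows "h \<in> sums_of_commutators n"
  unfolding sums_of_commutators_def using assms by blast

lemma sums_of_commutatorsE:
  assumes "h \<in> sums_of_commutators n"
  obtains f g and m :: nat where "h = (\<Sum>j<m. f j * g j - g j * f j)"
    "\<forall>j<m. f j \<in> nc_polys n" "\<forall>j<m. g j \<in> nc_polys n"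
  using assms unfolding sums_of_commutators_def by blast

lemma sums_of_commutators_add:
  assumes "h \<in> sums_of_commutators n" "h' \<in> sums_of_commutators n"
  shows "h + h' \<in> sums_of_commutators n"
proof -
  from assms(1) obtain f g and m :: nat where h: "h = (\<Sum>j<m. f j * g j - g j * f j)"
      "\<forall>j<m. f j \<in> nc_polys n" "\<forall>j<m. g j \<in> nc_polys n"
    by (rule sums_of_commutatorsE)
  from assms(2) obtain f' g' and m' :: nat where h': "h' = (\<Sum>j<m'. f' j * g' j - g' j * f' j)"
      "\<forall>j<m'. f' j \<in> nc_polys n" "\<forall>j<m'. g' j \<in> nc_polys n"
    by (rule sums_of_commutatorsE)
  \<comment> \<open>A commutator depends on two polynomials; pairing them makes it a function of a
    single family, as concatenation requires.\<close>
  define r where "r j = (if j < m then (f j, g j) else (f' (j - m), g' (j - m)))" for j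
  show ?thesis
  proof (rule sums_of_commutatorsI)
    show "h + h' = (\<Sum>j<m + m'. fst (r j) * snd (r j) - snd (r j) * fst (r j))"
      using sum_lessThan_append [of "\<lambda>p. fst p * snd p - snd p * fst p"
          "\<lambda>j. (f j, g j)" m "\<lambda>j. (f' j, g' j)" m']
      by (simp add: h h' r_def)
  qed (use h h' in \<open>auto simp: r_def\<close>)
qed

text \<open>The central constant is absorbed into the first entry of each commutator, whatever its
  sign.\<close>

lemma sums_of_commutators_scale:
  assumes "h \<in> sums_of_commutators n"
  shows "nc_const c * h \<in> sums_of_commutators n"
proof -
  from assms obtain f g and m :: nat where h: "h = (\<Sum>j<m. f j * g j - g j * f j)"
      "\<forall>j<m. f j \<in> nc_polys n" "\<forall>j<m. g j \<in> nc_polys n"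
    by (rule sums_of_commutatorsE)
  have "g j * (nc_const c * f j) = nc_const c * (g j * f j)" for j
    by (simp only: mult.assoc [symmetric] nc_const_commute [of c "g j"])
  then have "nc_const c * h = (\<Sum>j<m. (nc_const c * f j) * g j - g j * (nc_const c * f j))"
    by (simp add: h(1) sum_distrib_left right_diff_distrib mult.assoc)
  then show ?thesis
    by (rule sums_of_commutatorsI) (use h in \<open>auto intro: nc_polys_mult\<close>)
qed

lemma tr_M_ballI:
  fixes m0 m1 :: nat
  assumes "p = h + (\<Sum>j<m0. f j * nc_star (f j))
        + (\<Sum>j<m1. g j * (1 - (\<Sum>i<n. nc_var i ^ 2)) * nc_star (g j))"
    "h \<in> sums_of_commutators n" "\<forall>j<m0. f j \<in> nc_polys n" "\<forall>j<m1. g j \<in> nc_polys n"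
  shows "p \<in> tr_M_ball n"
  unfolding tr_M_ball_def mem_Collect_eq 
  by (intro exI [of _ h] exI [of _ f] exI [of _ g] exI [of _ m0] exI [of _ m1] conjI assms)

lemma tr_M_ballE:
  assumes "p \<in> tr_M_ball n"
  obtains h f g and m0 m1 :: nat where "p = h + (\<Sum>j<m0. f j * nc_star (f j))
        + (\<Sum>j<m1. g j * (1 - (\<Sum>i<n. nc_var i ^ 2)) * nc_star (g j))"
    "h \<in> sums_of_commutators n" "\<forall>j<m0. f j \<in> nc_polys n" "\<forall>j<m1. g j \<in> nc_polys n"
  using assms unfolding tr_M_ball_def mem_Collect_eq by (elim exE conjE) rule

lemma tr_M_ball_add:
  assumes "p \<in> tr_M_ball n" "q \<in> tr_M_ball n"
  shows "p + q \<in> tr_M_ball n"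
proof -
  from assms(1) obtain h f g and m0 m1 :: nat where p: "p = h + (\<Sum>j<m0. f j * nc_star (f j))
        + (\<Sum>j<m1. g j * (1 - (\<Sum>i<n. nc_var i ^ 2)) * nc_star (g j))"
    "h \<in> sums_of_commutators n" "\<forall>j<m0. f j \<in> nc_polys n" "\<forall>j<m1. g j \<in> nc_polys n"
    by (rule tr_M_ballE)
  from assms(2) obtain h' f' g' and k0 k1 :: nat where q: "q = h' + (\<Sum>j<k0. f' j * nc_star (f' j))
        + (\<Sum>j<k1. g' j * (1 - (\<Sum>i<n. nc_var i ^ 2)) * nc_star (g' j))"
    "h' \<in> sums_of_commutators n" "\<forall>j<k0. f' j \<in> nc_polys n" "\<forall>j<k1. g' j \<in> nc_polys n"
    by (rule tr_M_ballE)
  show ?thesis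
  proof (rule tr_M_ballI)
    show "p + q = (h + h')
        + (\<Sum>j<m0 + k0. (if j < m0 then f j else f' (j - m0)) * nc_star (if j < m0 then f j else f' (j - m0)))
        + (\<Sum>j<m1 + k1. (if j < m1 then g j else g' (j - m1)) * (1 - (\<Sum>i<n. nc_var i ^ 2))
            * nc_star (if j < m1 then g j else g' (j - m1)))"
      unfolding p(1) q(1) sum_lessThan_append [of "\<lambda>f. f * nc_star f", symmetric]
        sum_lessThan_append [of "\<lambda>g. g * (1 - (\<Sum>i<n. nc_var i ^ 2)) * nc_star g", symmetric]
      by (simp only: ac_simps)
    show "h + h' \<in> sums_of_commutators n"
      using p q by (simp add: sums_of_commutators_add)
  qed (use p q in auto)
qed

text \<open>A nonnegative constant has a real square root, and being central it can be distributed
  over the two outer factors of each square and each weighted square.\<close>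

lemma tr_M_ball_scale:
  assumes "p \<in> tr_M_ball n" "c \<ge> 0"
  shows "nc_const c * p \<in> tr_M_ball n"
proof -
  from assms(1) obtain h f g and m0 m1 :: nat where p: "p = h + (\<Sum>j<m0. f j * nc_star (f j))
        + (\<Sum>j<m1. g j * (1 - (\<Sum>i<n. nc_var i ^ 2)) * nc_star (g j))"
    "h \<in> sums_of_commutators n" "\<forall>j<m0. f j \<in> nc_polys n" "\<forall>j<m1. g j \<in> nc_polys n"
    by (rule tr_M_ballE)
  define s where "s = nc_const (sqrt c)"
  have c: "nc_const c = s * s"
    using assms(2) by (simp add: s_def flip: nc_const_mult)
  have star: "nc_star (s * q) = nc_star q * s" for q
    by (simp add: nc_star_mult s_def)
  \<comment> \<open>The left factor \<open>u\<close> is kept independent of \<open>q\<close> so that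
    one identity serves both \<open>f * nc_star f\<close> and the products with the ball polynomial
    in the middle.\<close>
  have comm: "nc_const c * (u * nc_star q) = s * u * nc_star (s * q)" for u q
  proof -
    have "nc_const c * (u * nc_star q) = s * (s * (u * nc_star q))"
      by (simp only: c mult.assoc)
    also have "s * (u * nc_star q) = (u * nc_star q) * s"
      unfolding s_def by (rule nc_const_commute)
    finally show ?thesis
      by (simp only: star mult.assoc)
  qed
  show ?thesis
  proof (rule tr_M_ballI)
    show "nc_const c * p = nc_const c * h + (\<Sum>j<m0. (s * f j) * nc_star (s * f j))
        + (\<Sum>j<m1. (s * g j) * (1 - (\<Sum>i<n. nc_var i ^ 2)) * nc_star (s * g j))"
      unfolding p(1) distrib_left sum_distrib_left comm by (simp only: mult.assoc)
    show "nc_const c * h \<in> sums_of_commutators n"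
      using p by (simp add: sums_of_commutators_scale)
  qed (use p in \<open>auto simp: s_def intro: nc_polys_mult\<close>)
qed

lemma convex_K_nc: "convex_mats (K_nc n \<epsilon>)"
  unfolding convex_mats_def
proof (intro ballI allI impI)
  fix A B :: "real mat" and u v :: real
  assume A: "A \<in> K_nc n \<epsilon>" and B: "B \<in> K_nc n \<epsilon>" and uv: "u \<ge> 0" "v \<ge> 0" "u + v = 1"
  have sym: "A \<in> sym_mats n" "B \<in> sym_mats n"
    using A B by (simp_all add: K_nc_def)
  then have carr: "A \<in> carrier_mat n n" "B \<in> carrier_mat n n"
    by (simp_all add: sym_mats_def)
  have "u \<cdot>\<^sub>m A + v \<cdot>\<^sub>m B \<in> sym_mats n"
  proof -
    have "(u \<cdot>\<^sub>m A + v \<cdot>\<^sub>m B)\<^sup>T = u \<cdot>\<^sub>m A\<^sup>T + v \<cdot>\<^sub>m B\<^sup>T"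
      by (rule eq_matI) (use carr in auto)
    then show ?thesis
      using sym by (simp add: sym_mats_def)
  qed
  \<comment> \<open>As the weights add up to one, the shift by \<open>\<epsilon>\<close> splits in
    the same proportions as the matrices.\<close>
  moreover have "nc_const \<epsilon> = nc_const u * nc_const \<epsilon> + nc_const v * nc_const \<epsilon>"
    using uv by (simp flip: nc_const_mult nc_const_add distrib_right)
  then have "p_poly n (u \<cdot>\<^sub>m A + v \<cdot>\<^sub>m B) + nc_const \<epsilon>
      = nc_const u * (p_poly n A + nc_const \<epsilon>) + nc_const v * (p_poly n B + nc_const \<epsilon>)"
    by (simp add: p_poly_combination [OF carr] distrib_left ac_simps)
  then have "p_poly n (u \<cdot>\<^sub>m A + v \<cdot>\<^sub>m B) + nc_const \<epsilon> \<in> tr_M_ball n"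
    using A B uv by (simp add: K_nc_def tr_M_ball_add tr_M_ball_scale)
  ultimately show "u \<cdot>\<^sub>m A + v \<cdot>\<^sub>m B \<in> K_nc n \<epsilon>"
    by (simp add: K_nc_def)
qed


section \<open>Evaluation and trace\<close>

lemma mtrace_add:
  "A \<in> carrier_mat d d \<Longrightarrow> B \<in> carrier_mat d d \<Longrightarrow> mtrace (A + B) = mtrace A + mtrace B"
  by (simp add: mtrace_def sum.distrib)

lemma mtrace_mult:
  assumes "A \<in> carrier_mat d d" "B \<in> carrier_mat d d"
  shows "mtrace (A * B) = (\<Sum>i<d. \<Sum>j<d. A $$ (i, j) * B $$ (j, i))"
  unfolding mtrace_def using assms by (simp add: index_mult_mat_sum [of _ d] del: index_mult_mat(1))

lemma mtrace_mult_commute: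
  assumes "A \<in> carrier_mat d d" "B \<in> carrier_mat d d"
  shows "mtrace (A * B) = mtrace (B * A)"
  unfolding mtrace_mult [OF assms] mtrace_mult [OF assms(2,1)]
  by (subst sum.swap) (simp add: mult.commute)

text \<open>Each diagonal entry of the conjugate is the quadratic form of \<open>P\<close> at the
  corresponding row of \<open>G\<close>.\<close>

lemma mtrace_conjugate_psd_nonneg:
  assumes P: "P \<in> psd_mats d" and G: "G \<in> carrier_mat d d"
  shows "0 \<le> mtrace (G * P * G\<^sup>T)"
proof -
  have carr: "P \<in> carrier_mat d d" "G\<^sup>T \<in> carrier_mat d d"
    using P G by (simp_all add: psd_mats_carrier)
  have "(G * (P * G\<^sup>T)) $$ (i, i) = row G i \<bullet> (P *\<^sub>v row G i)" if "i < d" for i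
  proof -
    have "(G * (P * G\<^sup>T)) $$ (i, i) = row G i \<bullet> col (P * G\<^sup>T) i"
      using that G carr by (intro index_mult_mat(1)) auto
    also have "col (P * G\<^sup>T) i = P *\<^sub>v row G i"
      using that G carr by (simp add: col_mult2 [OF carr])
    finally show ?thesis .
  qed
  moreover have "G * P * G\<^sup>T = G * (P * G\<^sup>T)"
    by (rule assoc_mult_mat [OF G carr])
  moreover have "row G i \<in> carrier_vec d" for i
    using G by auto
  ultimately show ?thesis
    using P G by (auto simp: mtrace_def psd_mats_def intro!: sum_nonneg)
qed

lemma one_minus_psdI:
  assumes P: "P \<in> sym_mats d"
    and le: "\<And>v. v \<in> carrier_vec d \<Longrightarrow> v \<bullet> (P *\<^sub>v v) \<le> v \<bullet> v"
  shows "1\<^sub>m d - P \<in> psd_mats d"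
proof -
  have carr: "P \<in> carrier_mat d d"
    using P by (rule sym_mats_carrier)
  have "(1\<^sub>m d - P)\<^sup>T = 1\<^sub>m d - P\<^sup>T"
    by (rule eq_matI) (use carr in auto)
  moreover have "1\<^sub>m d - P \<in> carrier_mat d d"
    using carr by (rule minus_carrier_mat)
  ultimately have "1\<^sub>m d - P \<in> sym_mats d"
    using P by (simp add: sym_mats_def)
  moreover have "0 \<le> v \<bullet> ((1\<^sub>m d - P) *\<^sub>v v)" if v: "v \<in> carrier_vec d" for v
  proof -
    have "(1\<^sub>m d - P) *\<^sub>v v = v - P *\<^sub>v v"
      using v carr by (simp add: minus_mult_distrib_mat_vec [OF one_carrier_mat carr v])
    moreover have "P *\<^sub>v v \<in> carrier_vec d"
      using carr v by (rule mult_mat_vec_carrier)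
    ultimately show ?thesis
      using le [OF v] v by (simp add: scalar_prod_minus_distrib [of _ d])
  qed
  ultimately show ?thesis
    by (simp add: psd_mats_def)
qed

lemma zero_sym_mats [simp]: "0\<^sub>m d d \<in> sym_mats d"
  by (simp add: sym_mats_def)

lemma one_psd_mats: "1\<^sub>m d \<in> psd_mats d"
  by (simp add: psd_mats_def sym_mats_def scalar_prod_self_nonneg)

lemma square_psd_mats:
  assumes "X \<in> sym_mats d"
  shows "X * X \<in> psd_mats d"
proof -
  have carr: "X \<in> carrier_mat d d"
    using assms by (rule sym_mats_carrier)
  have "v \<bullet> (X * X *\<^sub>v v) = (X *\<^sub>v v) \<bullet> (X *\<^sub>v v)" if "v \<in> carrier_vec d" for v
    using sym_mats_scalar_prod [OF assms that mult_mat_vec_carrier [OF carr that]]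
    by (simp add: assoc_mult_mat_vec [OF carr carr that])
  moreover have "(X * X)\<^sup>T = X * X"
    using assms by (simp add: transpose_mult [OF carr carr] sym_mats_def)
  moreover have "X * X \<in> carrier_mat d d"
    using carr by simp
  ultimately show ?thesis
    by (simp add: psd_mats_def sym_mats_def scalar_prod_self_nonneg)
qed

section \<open>Evaluation at symmetric matrices as a homomorphism respecting the involution\<close>

definition nc_trace :: "nat \<Rightarrow> (nat \<Rightarrow> real mat) \<Rightarrow> nc_poly \<Rightarrow> real" where
  "nc_trace d X f = mtrace (nc_eval d X f)"

context
  fixes d :: nat and X :: "nat \<Rightarrow> real mat"
  assumes X: "\<And>i. X i \<in> sym_mats d"
begin

lemma point_carrier: "X i \<in> carrier_mat d d"
  using X by (rule sym_mats_carrier)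

lemma word_eval_carrier [simp]: "word_eval d X w \<in> carrier_mat d d"
proof -
  have "foldr (\<lambda>i A. X i * A) l (1\<^sub>m d) \<in> carrier_mat d d" for l
    by (induction l) (auto intro: mult_carrier_mat [OF point_carrier])
  then show ?thesis
    by (simp add: word_eval_def)
qed

lemma word_eval_Nil: "word_eval d X (Word []) = 1\<^sub>m d"
  by (simp add: word_eval_def)

lemma word_eval_Cons: "word_eval d X (Word (i # l)) = X i * word_eval d X (Word l)"
  by (simp add: word_eval_def)

lemma word_eval_add: "word_eval d X (u + v) = word_eval d X u * word_eval d X v"
proof -
  have "word_eval d X (Word (k @ l)) = word_eval d X (Word k) * word_eval d X (Word l)" for k l
  proof (induction k)
    case Nil
    show ?case
      using left_mult_one_mat [OF word_eval_carrier] by (simp add: word_eval_Nil)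
  next
    case (Cons i k)
    then show ?case
      using assoc_mult_mat [OF point_carrier word_eval_carrier word_eval_carrier]
      by (simp add: word_eval_Cons)
  qed
  from this [of "letters u" "letters v"] show ?thesis
    by (simp add: plus_nc_word_def)
qed

text \<open>Transposition reverses products and fixes the symmetric matrices \<open>X i\<close>;
  hence evaluation turns the involution into transposition.\<close>

lemma word_eval_rev_word: "word_eval d X (rev_word w) = (word_eval d X w)\<^sup>T"
proof -
  have "word_eval d X (Word (rev l)) = (word_eval d X (Word l))\<^sup>T" for l
  proof (induction l)
    case Nil
    show ?case
      by (simp add: word_eval_Nil)
  next
    case (Cons i l)
    have "word_eval d X (Word (rev (i # l))) = word_eval d X (Word (rev l)) * word_eval d X (Word [i])"
      by (simp add: word_eval_add [symmetric] plus_nc_word_def)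
    also have "word_eval d X (Word [i]) = X i"
      using right_mult_one_mat [OF point_carrier] by (simp add: word_eval_Nil word_eval_Cons)
    also have "X i = (X i)\<^sup>T"
      using X by (simp add: sym_mats_def)
    finally show ?case
      by (simp add: Cons word_eval_Cons transpose_mult [OF point_carrier word_eval_carrier])
  qed
  from this [of "letters w"] show ?thesis
    by (simp add: rev_word_def)
qed

lemma nc_eval_carrier [simp]: "nc_eval d X f \<in> carrier_mat d d"
  by (simp add: nc_eval_def)

lemma nc_eval_dim [simp]: "dim_row (nc_eval d X f) = d" "dim_col (nc_eval d X f) = d"
  by (simp_all add: nc_eval_def)

text \<open>Enlarging the support by words with coefficient zero allows \<open>f\<close>,
  \<open>g\<close> and \<open>f + g\<close> to be evaluated over one common index set.\<close>

lemma nc_eval_index: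
  assumes "finite S" "Poly_Mapping.keys f \<subseteq> S" "a < d" "b < d"
  shows "nc_eval d X f $$ (a, b) = (\<Sum>w\<in>S. Poly_Mapping.lookup f w * word_eval d X w $$ (a, b))"
proof -
  have "nc_eval d X f $$ (a, b)
      = (\<Sum>w\<in>Poly_Mapping.keys f. Poly_Mapping.lookup f w * word_eval d X w $$ (a, b))"
    using assms by (simp add: nc_eval_def)
  also have "\<dots> = (\<Sum>w\<in>S. Poly_Mapping.lookup f w * word_eval d X w $$ (a, b))"
    by (rule sum.mono_neutral_left) (use assms in \<open>auto simp: in_keys_iff\<close>)
  finally show ?thesis .
qed

lemma nc_eval_add: "nc_eval d X (f + g) = nc_eval d X f + nc_eval d X g"
proof (rule eq_matI)
  fix a b
  assume "a < dim_row (nc_eval d X f + nc_eval d X g)" "b < dim_col (nc_eval d X f + nc_eval d X g)"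
  then have ab: "a < d" "b < d"
    by simp_all
  have "nc_eval d X q $$ (a, b) = (\<Sum>w\<in>Poly_Mapping.keys f \<union> Poly_Mapping.keys g.
      Poly_Mapping.lookup q w * word_eval d X w $$ (a, b))" if "q \<in> {f, g, f + g}" for q
    by (rule nc_eval_index) (use ab that Poly_Mapping.keys_add [of f g] in auto)
  then show "nc_eval d X (f + g) $$ (a, b) = (nc_eval d X f + nc_eval d X g) $$ (a, b)"
    using ab by (simp add: lookup_add distrib_right sum.distrib)
qed simp_all

lemma nc_eval_single: "nc_eval d X (Poly_Mapping.single w c) = c \<cdot>\<^sub>m word_eval d X w"
proof (rule eq_matI)
  fix a b
  assume "a < dim_row (c \<cdot>\<^sub>m word_eval d X w)" "b < dim_col (c \<cdot>\<^sub>m word_eval d X w)"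
  moreover have "dim_row (word_eval d X w) = d" "dim_col (word_eval d X w) = d"
    using carrier_matD [OF word_eval_carrier] by auto
  ultimately show "nc_eval d X (Poly_Mapping.single w c) $$ (a, b) = (c \<cdot>\<^sub>m word_eval d X w) $$ (a, b)"
    by (subst nc_eval_index [where S = "{w}"]) auto
qed (use carrier_matD [OF word_eval_carrier] in auto)

lemma nc_eval_zero: "nc_eval d X 0 = 0\<^sub>m d d"
  by (rule eq_matI) (auto simp: nc_eval_def)

lemma nc_eval_const: "nc_eval d X (nc_const c) = c \<cdot>\<^sub>m 1\<^sub>m d"
  by (simp add: nc_const_def nc_eval_single zero_nc_word_def word_eval_Nil)

lemma nc_eval_one: "nc_eval d X 1 = 1\<^sub>m d"
proof -
  have "1 = nc_const 1"
    by (simp add: nc_const_def)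
  then show ?thesis
    using nc_eval_const [of 1] by (auto intro!: eq_matI)
qed

lemma nc_eval_single_mult:
  "nc_eval d X (Poly_Mapping.single w c * f) = nc_eval d X (Poly_Mapping.single w c) * nc_eval d X f"
proof (induction f rule: poly_mapping_single_plus_induct)
  case zero
  show ?case
    using right_mult_zero_mat [OF nc_eval_carrier] by (simp add: nc_eval_zero)
next
  case (plus v e f)
  have "nc_eval d X (Poly_Mapping.single w c * Poly_Mapping.single v e)
      = (c * e) \<cdot>\<^sub>m (word_eval d X w * word_eval d X v)"
    by (simp add: mult_single nc_eval_single word_eval_add)
  also have "\<dots> = nc_eval d X (Poly_Mapping.single w c) * nc_eval d X (Poly_Mapping.single v e)"
  proof -
    have "(c \<cdot>\<^sub>m word_eval d X w) * (e \<cdot>\<^sub>m word_eval d X v)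
        = c \<cdot>\<^sub>m (word_eval d X w * (e \<cdot>\<^sub>m word_eval d X v))"
      by (rule mult_smult_assoc_mat [OF word_eval_carrier smult_carrier_mat [OF word_eval_carrier]])
    also have "word_eval d X w * (e \<cdot>\<^sub>m word_eval d X v) = e \<cdot>\<^sub>m (word_eval d X w * word_eval d X v)"
      by (rule mult_smult_distrib [OF word_eval_carrier word_eval_carrier])
    finally show ?thesis
      unfolding nc_eval_single by (auto intro!: eq_matI)
  qed
  finally show ?case
    by (simp add: distrib_left nc_eval_add plus
        mult_add_distrib_mat [OF nc_eval_carrier nc_eval_carrier nc_eval_carrier])
qed

lemma nc_eval_mult: "nc_eval d X (f * g) = nc_eval d X f * nc_eval d X g"
proof (induction f rule: poly_mapping_single_plus_induct)
  case zero
  show ?case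
    using left_mult_zero_mat [OF nc_eval_carrier] by (simp add: nc_eval_zero)
next
  case (plus w c f)
  then show ?case
    by (simp add: distrib_right nc_eval_add nc_eval_single_mult
        add_mult_distrib_mat [OF nc_eval_carrier nc_eval_carrier nc_eval_carrier])
qed

lemma nc_eval_star: "nc_eval d X (nc_star f) = (nc_eval d X f)\<^sup>T"
proof (induction f rule: poly_mapping_single_plus_induct)
  case zero
  show ?case
    by (simp add: nc_eval_zero)
next
  case (plus w c f)
  have "nc_eval d X (nc_star (Poly_Mapping.single w c)) = (nc_eval d X (Poly_Mapping.single w c))\<^sup>T"
    unfolding nc_star_single nc_eval_single word_eval_rev_word by (rule eq_matI) auto
  then show ?case
    by (simp add: nc_star_add nc_eval_add plus transpose_add [OF nc_eval_carrier nc_eval_carrier])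
qed

lemma nc_eval_sum_index:
  assumes "a < d" "b < d"
  shows "nc_eval d X (\<Sum>i\<in>I. f i) $$ (a, b) = (\<Sum>i\<in>I. nc_eval d X (f i) $$ (a, b))"
  using assms by (induction I rule: infinite_finite_induct) (simp_all add: nc_eval_zero nc_eval_add)

lemma nc_eval_diff: "nc_eval d X (f - g) = nc_eval d X f - nc_eval d X g"
proof -
  have "nc_eval d X f = nc_eval d X (f - g) + nc_eval d X g"
    by (simp add: nc_eval_add [symmetric])
  then show ?thesis
    by (auto intro!: eq_matI)
qed

lemma nc_eval_var_power2: "nc_eval d X (nc_var i ^ 2) = X i * X i"
proof -
  have "word_eval d X (Word [i, i]) = X i * X i"
    using right_mult_one_mat [OF point_carrier] by (simp add: word_eval_Cons word_eval_Nil)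
  then show ?thesis
    by (auto simp: nc_var_power2 nc_eval_single intro!: eq_matI)
qed

lemma nc_eval_ball:
  "nc_eval d X (1 - (\<Sum>i<n. nc_var i ^ 2))
    = 1\<^sub>m d - mat d d (\<lambda>(a, b). \<Sum>i<n. (X i * X i) $$ (a, b))"
proof -
  have "nc_eval d X (\<Sum>i<n. nc_var i ^ 2) = mat d d (\<lambda>(a, b). \<Sum>i<n. (X i * X i) $$ (a, b))"
    by (rule eq_matI) (auto simp: nc_eval_sum_index nc_eval_var_power2)
  then show ?thesis
    by (simp add: nc_eval_diff nc_eval_one)
qed

lemma nc_trace_add: "nc_trace d X (f + g) = nc_trace d X f + nc_trace d X g"
  by (simp add: nc_trace_def nc_eval_add mtrace_add [OF nc_eval_carrier nc_eval_carrier])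

lemma nc_trace_sum: "nc_trace d X (sum f I) = (\<Sum>i\<in>I. nc_trace d X (f i))"
  by (induction I rule: infinite_finite_induct)
    (simp_all add: nc_trace_add, simp_all add: nc_trace_def nc_eval_zero mtrace_def)

lemma nc_trace_commutator: "nc_trace d X (f * g - g * f) = 0"
proof -
  have "nc_trace d X (f * g) = nc_trace d X (f * g - g * f) + nc_trace d X (g * f)"
    by (simp flip: nc_trace_add)
  moreover have "nc_trace d X (f * g) = nc_trace d X (g * f)"
    unfolding nc_trace_def nc_eval_mult by (rule mtrace_mult_commute [OF nc_eval_carrier nc_eval_carrier])
  ultimately show ?thesis
    by simp
qed

lemma nc_trace_conjugate_nonneg:
  assumes "nc_eval d X q \<in> psd_mats d"
  shows "0 \<le> nc_trace d X (g * q * nc_star g)"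
  unfolding nc_trace_def nc_eval_mult nc_eval_star
  using assms by (rule mtrace_conjugate_psd_nonneg) simp

text \<open>The soundness of the certificates: commutators have trace zero, and every other summand
  evaluates to a conjugate of a positive semidefinite matrix.\<close>

lemma tr_M_ball_trace_nonneg:
  assumes "p \<in> tr_M_ball n"
    and ball: "1\<^sub>m d - mat d d (\<lambda>(a, b). \<Sum>i<n. (X i * X i) $$ (a, b)) \<in> psd_mats d"
  shows "0 \<le> nc_trace d X p"
proof -
  from assms(1) obtain h f g and m0 m1 :: nat where p: "p = h + (\<Sum>j<m0. f j * nc_star (f j))
        + (\<Sum>j<m1. g j * (1 - (\<Sum>i<n. nc_var i ^ 2)) * nc_star (g j))"
    and h: "h \<in> sums_of_commutators n"
    by (rule tr_M_ballE)
  from h have "nc_trace d X h = 0"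
    by (rule sums_of_commutatorsE) (simp add: nc_trace_sum nc_trace_commutator)
  \<comment> \<open>A plain square is treated as a weighted one whose weight is the polynomial
    \<open>1\<close>, evaluating to the identity matrix.\<close>
  moreover have "0 \<le> nc_trace d X (f j * nc_star (f j))" for j
    using nc_trace_conjugate_nonneg [of 1 "f j"] by (simp add: nc_eval_one one_psd_mats)
  moreover have "0 \<le> nc_trace d X (g j * (1 - (\<Sum>i<n. nc_var i ^ 2)) * nc_star (g j))" for j
    by (rule nc_trace_conjugate_nonneg) (simp only: nc_eval_ball ball)
  ultimately show ?thesis
    unfolding p nc_trace_add nc_trace_sum by (simp add: sum_nonneg add_nonneg_nonneg)
qed

lemma nc_trace_const: "nc_trace d X (nc_const c) = c * d"
  by (simp add: nc_trace_def nc_eval_const mtrace_def)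

text \<open>The bridge between the two sides of the theorem: the trace pairs \<open>M\<close> with
  the Gram matrix of the squares of the \<open>X i\<close>.\<close>

lemma nc_trace_p_poly:
  "nc_trace d X (p_poly n M) = (\<Sum>i<n. \<Sum>j<n. M $$ (i, j) * mat_inner (X i * X i) (X j * X j))"
proof -
  have XX: "X i * X i \<in> carrier_mat d d" for i
    by (rule mult_carrier_mat [OF point_carrier point_carrier])
  have "nc_trace d X (nc_const c * nc_var i ^ 2 * nc_var j ^ 2) = c * mat_inner (X i * X i) (X j * X j)"
    for c i j
  proof -
    have "nc_const c * nc_var i ^ 2 * nc_var j ^ 2 = nc_const c * (nc_var i ^ 2 * nc_var j ^ 2)"
      by (rule mult.assoc)
    then have "nc_eval d X (nc_const c * nc_var i ^ 2 * nc_var j ^ 2)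
        = (c \<cdot>\<^sub>m 1\<^sub>m d) * ((X i * X i) * (X j * X j))"
      by (simp only: nc_eval_mult nc_eval_const nc_eval_var_power2)
    also have "\<dots> = c \<cdot>\<^sub>m (1\<^sub>m d * ((X i * X i) * (X j * X j)))"
      by (rule mult_smult_assoc_mat [OF one_carrier_mat mult_carrier_mat [OF XX XX]])
    also have "1\<^sub>m d * ((X i * X i) * (X j * X j)) = (X i * X i) * (X j * X j)"
      by (rule left_mult_one_mat [OF mult_carrier_mat [OF XX XX]])
    finally show ?thesis
      by (simp add: nc_trace_def mat_inner_def mtrace_def sum_distrib_left
          carrier_matD [OF point_carrier] del: index_mult_mat(1))
  qed
  then show ?thesis
    by (simp add: p_poly_def nc_trace_sum)
qed

end

section \<open>Points of the ball and the two inclusions\<close>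

lemma mat_inner_sym_mats:
  assumes "M \<in> sym_mats n" "A \<in> sym_mats n"
  shows "mat_inner M A = (\<Sum>i<n. \<Sum>j<n. M $$ (i, j) * A $$ (i, j))"
  unfolding mat_inner_def mtrace_mult [OF assms [THEN sym_mats_carrier]]
  by (intro sum.cong refl) (simp add: sym_mats_index [OF assms(2)])

lemma word_eval_cong:
  assumes "\<And>i. i \<in> set (letters w) \<Longrightarrow> X i = Y i"
  shows "word_eval d X w = word_eval d Y w"
  unfolding word_eval_def using assms by (intro foldr_cong) auto

text \<open>Evaluation lemmas assume every \<open>X i\<close> symmetric, while a point of the ball
  is constrained only for \<open>i < n\<close>. This lemma permits changing the matrices beyond
  \<open>n\<close>.\<close>

lemma nc_eval_cong:
  assumes "f \<in> nc_polys n" "\<And>i. i < n \<Longrightarrow> X i = Y i"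
  shows "nc_eval d X f = nc_eval d Y f"
proof -
  have "word_eval d X w = word_eval d Y w" if "w \<in> Poly_Mapping.keys f" for w
    by (rule word_eval_cong) (use assms that in \<open>auto simp: nc_polys_def\<close>)
  then show ?thesis
    unfolding nc_eval_def by (intro cong_mat) auto
qed

lemma K_nc_Inter_trace_nonneg:
  assumes M: "M \<in> (\<Inter>\<epsilon>\<in>{0<..}. K_nc n \<epsilon>)" and X: "\<And>i. X i \<in> sym_mats d"
    and ball: "1\<^sub>m d - mat d d (\<lambda>(a, b). \<Sum>i<n. (X i * X i) $$ (a, b)) \<in> psd_mats d"
  shows "0 \<le> (\<Sum>i<n. \<Sum>j<n. M $$ (i, j) * mat_inner (X i * X i) (X j * X j))"
proof (rule field_le_epsilon)
  fix e :: real
  assume "e > 0"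
  \<comment> \<open>The trace is not normalised, so the constant contributes
    \<open>\<epsilon> * d\<close>, and this choice keeps it at most \<open>e\<close>. The
    denominator \<open>d + 1\<close> is positive even for \<open>d = 0\<close>.\<close>
  define \<epsilon> where "\<epsilon> = e / (d + 1)"
  have "\<epsilon> > 0"
    using \<open>e > 0\<close> by (simp add: \<epsilon>_def)
  then have "p_poly n M + nc_const \<epsilon> \<in> tr_M_ball n"
    using M by (simp add: K_nc_def)
  from tr_M_ball_trace_nonneg [OF X this ball]
  have "0 \<le> (\<Sum>i<n. \<Sum>j<n. M $$ (i, j) * mat_inner (X i * X i) (X j * X j)) + \<epsilon> * d"
    by (simp add: nc_trace_add [OF X] nc_trace_p_poly [OF X] nc_trace_const [OF X])
  also have "\<epsilon> * d \<le> e"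
    using \<open>e > 0\<close> by (simp add: \<epsilon>_def field_simps)
  finally show "0 \<le> (\<Sum>i<n. \<Sum>j<n. M $$ (i, j) * mat_inner (X i * X i) (X j * X j)) + e"
    by simp
qed

text \<open>After a common scaling, the \<open>X i\<close> become squares of the coordinates of a
  point of the ball. One factor \<open>t\<close> for all indices is essential, because it multiplies
  the whole Gram matrix by \<open>t\<^sup>2\<close>.\<close>

lemma psd_family_ball:
  fixes n :: nat
  assumes X: "\<And>i. i < n \<Longrightarrow> X i \<in> psd_mats d"
  obtains t Y where "t > 0" "\<And>i. Y i \<in> sym_mats d" "\<And>i. i < n \<Longrightarrow> Y i * Y i = t \<cdot>\<^sub>m X i"
    "1\<^sub>m d - mat d d (\<lambda>(a, b). \<Sum>i<n. (Y i * Y i) $$ (a, b)) \<in> psd_mats d"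
proof -
  have "\<exists>c\<ge>0. \<forall>v\<in>carrier_vec d. v \<bullet> (X i *\<^sub>v v) \<le> c * (v \<bullet> v)" if "i < n" for i
    using quadratic_form_bound [OF psd_mats_carrier [OF X [OF that]]] by metis
  then obtain c where c: "\<And>i. i < n \<Longrightarrow> c i \<ge> 0"
    "\<And>i v. i < n \<Longrightarrow> v \<in> carrier_vec d \<Longrightarrow> v \<bullet> (X i *\<^sub>v v) \<le> c i * (v \<bullet> v)"
    by metis
  \<comment> \<open>The reciprocal of the total of the bounds; the extra \<open>1\<close> keeps the
    denominator positive when all of them vanish.\<close>
  define t where "t = 1 / (1 + (\<Sum>i<n. c i))"
  have "0 \<le> (\<Sum>i<n. c i)"
    using c by (intro sum_nonneg) auto
  then have t: "t > 0" "t * (\<Sum>i<n. c i) \<le> 1"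
    by (simp_all add: t_def)
  define Z where "Z i = t \<cdot>\<^sub>m X i" for i
  have Z: "Z i \<in> psd_mats d" if "i < n" for i
    unfolding Z_def by (rule psd_mats_smult) (use X that t in auto)
  have Z_le: "v \<bullet> (Z i *\<^sub>v v) \<le> t * c i * (v \<bullet> v)" if "i < n" "v \<in> carrier_vec d" for i v
  proof -
    have "X i \<in> carrier_mat d d"
      using X that by (simp add: psd_mats_carrier)
    then have "v \<bullet> (Z i *\<^sub>v v) = t * (v \<bullet> (X i *\<^sub>v v))"
      using that by (simp add: Z_def quadratic_form_eq [of _ d] sum_distrib_left mult.assoc)
    then show ?thesis
      using c(2) [OF that] t(1) by (simp add: mult.assoc mult_left_mono)
  qed
  have sum_le: "(\<Sum>i<n. v \<bullet> (Z i *\<^sub>v v)) \<le> v \<bullet> v" if v: "v \<in> carrier_vec d" for v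
  proof -
    have "(\<Sum>i<n. v \<bullet> (Z i *\<^sub>v v)) \<le> (\<Sum>i<n. t * c i * (v \<bullet> v))"
      using Z_le v by (intro sum_mono) auto
    also have "\<dots> = t * (\<Sum>i<n. c i) * (v \<bullet> v)"
      by (simp add: sum_distrib_left sum_distrib_right)
    also have "\<dots> \<le> 1 * (v \<bullet> v)"
      using t(2) by (rule mult_right_mono) (rule scalar_prod_self_nonneg)
    finally show ?thesis
      by simp
  qed
  have "\<exists>Y. Y \<in> sym_mats d \<and> Y * Y = Z i" if i: "i < n" for i
  proof -
    have "1\<^sub>m d - Z i \<in> psd_mats d"
    proof (rule one_minus_psdI)
      show "Z i \<in> sym_mats d"
        using Z [OF i] by (simp add: psd_mats_def)
      fix v :: "real vec"
      assume v: "v \<in> carrier_vec d"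
      \<comment> \<open>The remaining summands are nonnegative, so the bound on the sum passes to
        each single \<open>Z i\<close>, which is then a contraction and has a square root.\<close>
      have "v \<bullet> (Z i *\<^sub>v v) \<le> (\<Sum>i<n. v \<bullet> (Z i *\<^sub>v v))"
        by (rule member_le_sum) (use Z i v in \<open>auto simp: psd_mats_def\<close>)
      with sum_le [OF v] show "v \<bullet> (Z i *\<^sub>v v) \<le> v \<bullet> v"
        by simp
    qed
    then show ?thesis
      using psd_contraction_sqrt [OF Z [OF i]] by metis
  qed
  then obtain Y where Y: "\<And>i. i < n \<Longrightarrow> Y i \<in> sym_mats d" "\<And>i. i < n \<Longrightarrow> Y i * Y i = Z i"
    by metis
  \<comment> \<open>Zero matrices beyond \<open>n\<close> make every coordinate symmetric without
    changing the sum of squares over \<open>i < n\<close>.\<close>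
  define Y' where "Y' i = (if i < n then Y i else 0\<^sub>m d d)" for i
  define S where "S = mat d d (\<lambda>(a, b). \<Sum>i<n. Z i $$ (a, b))"
  have "1\<^sub>m d - S \<in> psd_mats d"
  proof (rule one_minus_psdI)
    have "Z i $$ (a, b) = Z i $$ (b, a)" if "i < n" "a < d" "b < d" for i a b
      using Z that sym_mats_index [of "Z i" d a b] by (simp add: psd_mats_def)
    then show "S \<in> sym_mats d"
      by (auto simp: S_def sym_mats_def intro!: eq_matI sum.cong)
    fix v :: "real vec"
    assume v: "v \<in> carrier_vec d"
    have "v \<bullet> (S *\<^sub>v v) = (\<Sum>a<d. \<Sum>b<d. \<Sum>i<n. Z i $$ (a, b) * (v $ a * v $ b))"
      using v by (subst quadratic_form_eq [of _ d]) (simp_all add: S_def sum_distrib_right)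
    also have "\<dots> = (\<Sum>a<d. \<Sum>i<n. \<Sum>b<d. Z i $$ (a, b) * (v $ a * v $ b))"
      by (rule sum.cong [OF refl]) (rule sum.swap)
    also have "\<dots> = (\<Sum>i<n. \<Sum>a<d. \<Sum>b<d. Z i $$ (a, b) * (v $ a * v $ b))"
      by (rule sum.swap)
    also have "\<dots> = (\<Sum>i<n. v \<bullet> (Z i *\<^sub>v v))"
      by (intro sum.cong refl quadratic_form_eq [symmetric]) (use Z v psd_mats_carrier in auto)
    finally show "v \<bullet> (S *\<^sub>v v) \<le> v \<bullet> v"
      using sum_le [OF v] by simp
  qed
  moreover have "S = mat d d (\<lambda>(a, b). \<Sum>i<n. (Y' i * Y' i) $$ (a, b))"
    unfolding S_def Y'_def by (intro cong_mat refl) (auto simp: Y intro!: sum.cong)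
  ultimately have ball: "1\<^sub>m d - mat d d (\<lambda>(a, b). \<Sum>i<n. (Y' i * Y' i) $$ (a, b)) \<in> psd_mats d"
    by simp
  show thesis
  proof (rule that [OF t(1) _ _ ball])
    show "Y' i \<in> sym_mats d" for i
      using Y by (simp add: Y'_def)
    show "Y' i * Y' i = t \<cdot>\<^sub>m X i" if "i < n" for i
      using Y that by (simp add: Y'_def Z_def)
  qed
qed

lemma K_nc_Inter_subset: "(\<Inter>\<epsilon>\<in>{0<..}. K_nc n \<epsilon>) \<subseteq> CS_plus_dual n"
proof
  fix M
  assume M: "M \<in> (\<Inter>\<epsilon>\<in>{0<..}. K_nc n \<epsilon>)"
  then have sym: "M \<in> sym_mats n"
    \<comment> \<open>Symmetry is extracted from membership for the sample value
      \<open>\<epsilon> = 1\<close>.\<close>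
    by (auto simp: K_nc_def dest: bspec [of _ _ 1])
  have "0 \<le> mat_inner M A" if CS: "A \<in> CS_plus n" for A
  proof -
    obtain d and X :: "nat \<Rightarrow> real mat" where A: "A \<in> sym_mats n" and X: "\<forall>i<n. X i \<in> psd_mats d"
      and AX: "\<forall>i<n. \<forall>j<n. A $$ (i, j) = mat_inner (X i) (X j)"
      using CS unfolding CS_plus_def by blast
    obtain t Y where t: "t > 0" and Y: "\<And>i. Y i \<in> sym_mats d"
      and YX: "\<And>i. i < n \<Longrightarrow> Y i * Y i = t \<cdot>\<^sub>m X i"
      and ball: "1\<^sub>m d - mat d d (\<lambda>(a, b). \<Sum>i<n. (Y i * Y i) $$ (a, b)) \<in> psd_mats d"
      by (rule psd_family_ball [of n X d]) (use X in auto)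
    have "mat_inner (Y i * Y i) (Y j * Y j) = t\<^sup>2 * A $$ (i, j)" if "i < n" "j < n" for i j
    proof -
      have carr: "X i \<in> carrier_mat d d" "X j \<in> carrier_mat d d"
        using X that by (simp_all add: psd_mats_carrier)
      then show ?thesis
        by (simp add: YX AX that mat_inner_def mtrace_mult [of _ d] sum_distrib_left
            power2_eq_square mult_ac)
    qed
    then have "(\<Sum>i<n. \<Sum>j<n. M $$ (i, j) * mat_inner (Y i * Y i) (Y j * Y j))
        = t\<^sup>2 * mat_inner M A"
      by (simp add: mat_inner_sym_mats [OF sym A] sum_distrib_left mult_ac)
    \<comment> \<open>The positive factor \<open>t\<^sup>2\<close> is cancelled, leaving the sign of
      \<open>mat_inner M A\<close>.\<close>
    with K_nc_Inter_trace_nonneg [OF M Y ball] t show ?thesis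
      by (simp add: zero_le_mult_iff)
  qed
  with sym show "M \<in> CS_plus_dual n"
    by (simp add: CS_plus_dual_def)
qed

lemma CS_plus_dual_trace_nonneg:
  assumes M: "M \<in> CS_plus_dual n" and "d \<ge> 1" and X: "X \<in> nc_ball n d"
  shows "0 \<le> mtrace (nc_eval d X (p_poly n M))"
proof -
  \<comment> \<open>Extension of the point of the ball by zero, to be undone at the end since
    \<open>p_poly n M\<close> involves only the first \<open>n\<close> variables.\<close>
  define Y where "Y i = (if i < n then X i else 0\<^sub>m d d)" for i
  have Y: "Y i \<in> sym_mats d" for i
    using X by (simp add: Y_def nc_ball_def)
  have psd: "Y i * Y i \<in> psd_mats d" for i
    using Y by (rule square_psd_mats)
  \<comment> \<open>The test matrix against which \<open>M\<close> is paired: the Gram matrix of the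
    positive semidefinite squares, which are themselves the witnesses for
    \<open>CS_plus\<close>.\<close>
  define A where "A = mat n n (\<lambda>(i, j). mat_inner (Y i * Y i) (Y j * Y j))"
  have comm: "mat_inner (Y i * Y i) (Y j * Y j) = mat_inner (Y j * Y j) (Y i * Y i)" for i j
    unfolding mat_inner_def by (rule mtrace_mult_commute [OF psd [THEN psd_mats_carrier] psd [THEN psd_mats_carrier]])
  have "A\<^sup>T = A"
    by (rule eq_matI) (simp_all add: A_def, rule comm)
  then have sym: "A \<in> sym_mats n"
    by (simp add: A_def sym_mats_def)
  have "A \<in> CS_plus n"
    unfolding CS_plus_def mem_Collect_eq
  proof (intro conjI exI [of _ d] exI [of _ "\<lambda>i. Y i * Y i"] allI impI)
    show "A $$ (i, j) = mat_inner (Y i * Y i) (Y j * Y j)" if "i < n" "j < n" for i j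
      using that by (simp add: A_def)
  qed (rule sym \<open>d \<ge> 1\<close> psd)+
  then have "0 \<le> mat_inner M A" and "M \<in> sym_mats n"
    using M by (simp_all add: CS_plus_dual_def)
  then have "0 \<le> (\<Sum>i<n. \<Sum>j<n. M $$ (i, j) * mat_inner (Y i * Y i) (Y j * Y j))"
    using sym by (simp add: mat_inner_sym_mats) (simp add: A_def)
  also have "\<dots> = nc_trace d Y (p_poly n M)"
    by (rule nc_trace_p_poly [OF Y, symmetric])
  also have "\<dots> = mtrace (nc_eval d X (p_poly n M))"
    unfolding nc_trace_def
    by (intro arg_cong [where f = mtrace] nc_eval_cong [OF p_poly_in_nc_polys]) (simp add: Y_def)
  finally show ?thesis .
qed

theorem lemma3p17:
  fixes n :: nat
  assumes "n \<ge> 1"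
  shows "(\<forall>\<epsilon>\<ge>0. K_nc n \<epsilon> \<subseteq> sym_mats n \<and> convex_mats (K_nc n \<epsilon>))
    \<and> (\<Inter>\<epsilon>\<in>{0<..}. K_nc n \<epsilon>) \<subseteq> CS_plus_dual n
    \<and> (connes_embedding_conjecture \<longrightarrow> (\<Inter>\<epsilon>\<in>{0<..}. K_nc n \<epsilon>) = CS_plus_dual n)"
proof (intro conjI allI impI)
  show "K_nc n \<epsilon> \<subseteq> sym_mats n" for \<epsilon>
    by (auto simp: K_nc_def)
  show "convex_mats (K_nc n \<epsilon>)" for \<epsilon>
    by (rule convex_K_nc)
  show "(\<Inter>\<epsilon>\<in>{0<..}. K_nc n \<epsilon>) \<subseteq> CS_plus_dual n"
    by (rule K_nc_Inter_subset)
  assume connes: connes_embedding_conjecture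
  have "M \<in> K_nc n \<epsilon>" if M: "M \<in> CS_plus_dual n" and "\<epsilon> > 0" for M \<epsilon>
  proof -
    have sym: "M \<in> sym_mats n"
      using M by (simp add: CS_plus_dual_def)
    \<comment> \<open>Trace-nonnegativity of the symmetric polynomial \<open>p_poly n M\<close> on
      balls of every size \<open>d \<ge> 1\<close> is what the conjecture converts into certificates
      for all positive \<open>\<epsilon>\<close>.\<close>
    have "\<forall>\<epsilon>>0. p_poly n M + nc_const \<epsilon> \<in> tr_M_ball n"
      using connes assms p_poly_in_nc_polys [of n M] nc_star_p_poly [OF sym]
        CS_plus_dual_trace_nonneg [OF M]
      unfolding connes_embedding_conjecture_def by blast
    with sym \<open>\<epsilon> > 0\<close> show ?thesis
      by (simp add: K_nc_def)
  qed
  then have "CS_plus_dual n \<subseteq> (\<Inter>\<epsilon>\<in>{0<..}. K_nc n \<epsilon>)"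
    by auto
  then show "(\<Inter>\<epsilon>\<in>{0<..}. K_nc n \<epsilon>) = CS_plus_dual n"
    using K_nc_Inter_subset by (intro equalityI)
qed

end
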